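(* Let $\varrho(n)$ denote the number of integers $a$ with $1\le a\le n$ for which there exists an integer $x$ with $a^2x\equiv a\pmod n$. Then there exist constants $D$ and $E$ such that, for real $x\ge 2$, \[ \sum_{n\le x}\frac{1}{\varrho(n)} = D\log x+E+O\left(\frac{\log^9 x}{x}\right), \] where \[ D=\frac{\zeta(2)\zeta(3)}{\zeta(6)}\prod_p\left(1-\frac{p(p-1)}{p^2-p+1}\sum_{\nu=1}^{\infty}\frac{1}{p^\nu(p^\nu-p^{\nu-1}+1)}\right), \] the product over all primes $p$ and $\zeta$ the Riemann zeta function.
   Context: An integer $a$ is called regular (mod $n$) if there is an integer $x$ with $a^2x\equiv a \pmod n$; $\varrho(n)$ counts regular integers (mod $n$) in $\{1,\dots,n\}$ (so $\varrho(1)=1$). Equivalently, $\varrho$ is multiplicative with $\varrho(p^\nu)=p^\nu-p^{\nu-1}+1$ for prime powers. *)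

theory Defs
  imports "HOL-Analysis.Analysis" "HOL-Number_Theory.Number_Theory"
begin

definition regular_mod :: "int \<Rightarrow> nat \<Rightarrow> bool" where
  "regular_mod a n \<longleftrightarrow> (\<exists>x::int. [a\<^sup>2 * x = a] (mod int n))"

definition rho :: "nat \<Rightarrow> nat" where
  "rho n = card {a::int. 1 \<le> a \<and> a \<le> int n \<and> regular_mod a n}"

text \<open>The Riemann zeta function by its Dirichlet series; only meaningful for real \<open>s > 1\<close>.\<close>

definition zeta :: "real \<Rightarrow> real" where
  "zeta s = (\<Sum>n. 1 / real (Suc n) powr s)"

lemma summable_zeta:
  assumes "s > 1"
  shows "summable (\<lambda>n. 1 / real (Suc n) powr s)"
proof -
  have "summable (\<lambda>n. real n powr (-s))"
    using assms by (simp add: summable_real_powr_iff)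
  then have "summable (\<lambda>n. real (Suc n) powr (-s))"
    by (subst summable_Suc_iff)
  then show ?thesis by (simp add: powr_minus divide_inverse)
qed

text \<open>The index \<open>k\<close> stands for \<open>\<nu> - 1\<close>, so the terms are
  \<open>1 / (p\<^sup>\<nu> (p\<^sup>\<nu> - p\<^sup>\<nu>\<^sup>-\<^sup>1 + 1))\<close> for \<open>\<nu> \<ge> 1\<close>.\<close>

definition local_term :: "nat \<Rightarrow> nat \<Rightarrow> real" where
  "local_term p k = 1 / (real p ^ Suc k * (real p ^ Suc k - real p ^ k + 1))"

definition local_factor :: "nat \<Rightarrow> real" where
  "local_factor p = 1 - real p * (real p - 1) / ((real p)\<^sup>2 - real p + 1) * (\<Sum>k. local_term p k)"

text \<open>The product over primes is an infinite product over all naturals with factor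
  \<open>1\<close> at non-primes.\<close>

definition D_const :: real where
  "D_const = zeta 2 * zeta 3 / zeta 6 * (\<Prod>p. if prime p then local_factor p else 1)"

text \<open>The series and the product converge, so neither takes an arbitrary default value.\<close>

lemma local_term_bounds:
  assumes "p \<ge> 2"
  shows "0 \<le> local_term p k" "local_term p k \<le> 2 / (real p)\<^sup>2 * (1 / 4) ^ k"
proof -
  define q where "q = real p ^ k"
  have q: "q \<ge> 2 ^ k" unfolding q_def using assms by (intro power_mono) auto
  then have q0: "q > 0" by (meson less_le_trans zero_less_numeral zero_less_power)
  have p2: "real p \<ge> 2" using assms by simp
  have "2 * q \<le> real p * q" using p2 q0 by (intro mult_right_mono) auto
  then have half: "real p * q / 2 \<le> real p * q - q + 1" by linarith
  have pq: "real p * q > 0" using p2 q0 by simp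
  have "q\<^sup>2 \<ge> (2 ^ k)\<^sup>2" using q by (intro power_mono) auto
  then have q4: "q\<^sup>2 \<ge> 4 ^ k"
    by (simp add: power2_eq_square power_mult_distrib[symmetric])
  have den: "real p * q - q + 1 > 0" using half pq by linarith
  have eq: "local_term p k = 1 / (real p * q * (real p * q - q + 1))"
    by (simp add: local_term_def q_def)
  show "0 \<le> local_term p k" unfolding eq using den pq
    by (intro divide_nonneg_nonneg mult_nonneg_nonneg[of "real p * q"]) linarith+
  have "local_term p k \<le> 1 / (real p * q * (real p * q / 2))"
    unfolding eq using half pq den
    by (intro divide_left_mono mult_left_mono mult_pos_pos[of "real p * q"]) (linarith | simp)+
  also have "\<dots> = 2 / (real p)\<^sup>2 * (1 / q\<^sup>2)"
    by (simp add: power2_eq_square field_simps)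
  also have "\<dots> \<le> 2 / (real p)\<^sup>2 * (1 / 4 ^ k)"
    using q4 q0 by (intro mult_left_mono divide_left_mono) auto
  finally show "local_term p k \<le> 2 / (real p)\<^sup>2 * (1 / 4) ^ k"
    by (simp add: power_one_over)
qed

lemma summable_local_term:
  assumes "p \<ge> 2"
  shows "summable (local_term p)"
proof (rule summable_comparison_test')
  show "summable (\<lambda>k. 2 / (real p)\<^sup>2 * (1 / 4) ^ k)"
    by (intro summable_mult summable_geometric) auto
  show "norm (local_term p k) \<le> 2 / (real p)\<^sup>2 * (1 / 4) ^ k" for k
    using local_term_bounds[OF assms, of k] by simp
qed

lemma abs_convergent_local_factor:
  "abs_convergent_prod (\<lambda>p. if prime p then local_factor p else 1)"
proof (rule summable_imp_abs_convergent_prod, rule summable_comparison_test')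
  show "summable (\<lambda>p. 8 / 3 * (1 / (real p)\<^sup>2))"
    by (intro summable_mult) (use inverse_power_summable[of 2, where 'a = real] in \<open>simp add: divide_inverse\<close>)
  fix p :: nat
  show "norm (norm ((if prime p then local_factor p else 1) - 1)) \<le> 8 / 3 * (1 / (real p)\<^sup>2)"
  proof (cases "prime p")
    case True
    then have p: "p \<ge> 2" by (rule prime_ge_2_nat)
    define S where "S = (\<Sum>k. local_term p k)"
    have S0: "S \<ge> 0" unfolding S_def
      by (intro suminf_nonneg summable_local_term p local_term_bounds)
    have "S \<le> (\<Sum>k. 2 / (real p)\<^sup>2 * (1 / 4) ^ k)" unfolding S_def
      by (intro suminf_le summable_local_term p local_term_bounds summable_mult summable_geometric) auto
    also have "\<dots> = 2 / (real p)\<^sup>2 * (\<Sum>k. (1 / 4) ^ k)"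
      by (intro suminf_mult summable_geometric) auto
    also have "\<dots> = 8 / 3 * (1 / (real p)\<^sup>2)"
      by (subst suminf_geometric) auto
    finally have S1: "S \<le> 8 / 3 * (1 / (real p)\<^sup>2)" .
    define c where "c = real p * (real p - 1) / ((real p)\<^sup>2 - real p + 1)"
    have n0: "real p * (real p - 1) \<ge> 0" using p by simp
    have "c \<ge> 0" "c \<le> 1"
      using n0 by (auto simp: c_def power2_eq_square algebra_simps)
    then have "c * S \<le> S" "c * S \<ge> 0"
      using S0 by (auto intro: mult_left_le_one_le)
    moreover have "local_factor p - 1 = - (c * S)"
      by (simp add: local_factor_def c_def S_def)
    ultimately show ?thesis using True S1 by simp
  qed simp
qed

end

theory Submission
  imports Defs
begin

text \<open>
  The function \<open>n / \<rho>(n)\<close> is multiplicative and equals \<open>1\<close> at primes, so its Moebius transform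
  \<open>g\<close> vanishes at primes; moreover \<open>0 \<le> g(p\<^sup>\<nu>) \<le> 2 / p\<^sup>\<nu>\<^sup>-\<^sup>1\<close> for \<open>\<nu> \<ge> 2\<close>, with constant
  \<open>1\<close> instead of \<open>2\<close> for \<open>\<nu> = 2\<close>. Comparing Euler products, the Dirichlet series
  \<open>\<Sum> g(d) / d\<^sup>e\<close> therefore grows no
  faster than \<open>\<zeta>(1 + e)\<close>, that is, it is \<open>O(1 / e)\<close> as \<open>e\<close> tends to \<open>0\<close>. Interchanging sums,
  \<open>\<Sum>\<^bsub>n \<le> x\<^esub> 1 / \<rho>(n) = \<Sum>\<^bsub>d\<^esub> (g(d) / d) H(x / d)\<close> with \<open>H(t) = \<Sum>\<^bsub>m \<le> t\<^esub> 1 / m\<close>. The estimate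
  \<open>H(t) = log t + \<gamma> + O(t\<^sup>e\<^sup>-\<^sup>1)\<close> holds for all \<open>t > 0\<close> (also for \<open>t < 1\<close>, where \<open>H(t) = 0\<close>),
  uniformly in \<open>0 < e \<le> 3/4\<close>. Hence no tail of the series has to be treated separately: the
  error is \<open>O(x\<^sup>e\<^sup>-\<^sup>1 / e)\<close>, and \<open>e = 1 / (2 log x)\<close> even gives \<open>O(log x / x)\<close>.
\<close>

section \<open>Multiplicative functions and Euler products\<close>

lemma has_sum_diff:
  fixes f g :: "'a \<Rightarrow> real"
  assumes "(f has_sum a) A" "(g has_sum b) A"
  shows "((\<lambda>x. f x - g x) has_sum (a - b)) A"
  using has_sum_add[OF assms(1) has_sum_uminusI[OF assms(2)]] by simp

definition multiplicative :: "(nat \<Rightarrow> real) \<Rightarrow> bool" where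
  "multiplicative F \<longleftrightarrow>
     F 1 = 1 \<and> (\<forall>a b. a > 0 \<longrightarrow> b > 0 \<longrightarrow> coprime a b \<longrightarrow> F (a * b) = F a * F b)"

lemma multiplicative_1: "multiplicative F \<Longrightarrow> F 1 = 1"
  by (simp add: multiplicative_def)

lemma multiplicative_coprime:
  "multiplicative F \<Longrightarrow> a > 0 \<Longrightarrow> b > 0 \<Longrightarrow> coprime a b \<Longrightarrow> F (a * b) = F a * F b"
  by (simp add: multiplicative_def)

lemma multiplicative_times:
  assumes "multiplicative F" "multiplicative G"
  shows "multiplicative (\<lambda>n. F n * G n)"
  using assms by (simp add: multiplicative_def)

lemma multiplicative_powr: "multiplicative (\<lambda>n. real n powr s)"
  by (simp add: multiplicative_def powr_mult)

text \<open>The condition \<open>n > 0\<close> matters: \<open>prime_factors 0\<close> is empty, so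
  0 would otherwise lie in every such set.\<close>

definition smooth_numbers :: "nat set \<Rightarrow> nat set" where
  "smooth_numbers P = {n. n > 0 \<and> prime_factors n \<subseteq> P}"

lemma smooth_numbers_empty: "smooth_numbers {} = {1}"
  by (auto simp: smooth_numbers_def prime_factorization_empty_iff)

lemma smooth_numbers_atMost: "{0<..N} \<subseteq> smooth_numbers {p. prime p \<and> p \<le> N}"
proof
  fix n assume "n \<in> {0<..N}"
  then show "n \<in> smooth_numbers {p. prime p \<and> p \<le> N}"
    by (auto simp: smooth_numbers_def prime_factors_dvd intro: order_trans[OF dvd_imp_le])
qed

text \<open>Induction on \<open>P\<close>: a number that is smooth over \<open>insert p P\<close> is
  uniquely \<open>p ^ k * m\<close> with \<open>m\<close> smooth over \<open>P\<close>, so adjoining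
  \<open>p\<close> multiplies the sum by the local series at \<open>p\<close>.\<close>

theorem has_sum_euler_product:
  assumes F: "multiplicative F" and nonneg: "\<And>n. n > 0 \<Longrightarrow> F n \<ge> 0"
    and P: "finite P" "\<And>p. p \<in> P \<Longrightarrow> prime p"
    and L: "\<And>p. p \<in> P \<Longrightarrow> ((\<lambda>k. F (p ^ k)) has_sum L p) UNIV"
  shows "(F has_sum (\<Prod>p\<in>P. L p)) (smooth_numbers P)"
  using P L
proof (induction P rule: finite_induct)
  case empty
  have "(F has_sum (\<Sum>n\<in>{1}. F n)) {1}" by (rule has_sum_finite) simp
  then show ?case by (simp add: smooth_numbers_empty multiplicative_1[OF F, simplified])
next
  case (insert p P)
  have p: "prime p" and IH: "(F has_sum (\<Prod>p\<in>P. L p)) (smooth_numbers P)"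
    using insert by auto
  have ndvd: "\<not> p dvd m" "m > 0" if "m \<in> smooth_numbers P" for m
    using that p insert.hyps by (auto simp: smooth_numbers_def prime_factors_dvd)
  have mult: "F (p ^ k * m) = F (p ^ k) * F m" if "m \<in> smooth_numbers P" for k :: nat and m
    using ndvd[OF that] p prime_gt_0_nat[OF p]
    by (intro multiplicative_coprime[OF F]) (auto intro: prime_imp_coprime)
  define h where "h = (\<lambda>(k :: nat, m). F (p ^ k) * F m)"
  have rows: "((\<lambda>m. h (k, m)) has_sum F (p ^ k) * (\<Prod>p\<in>P. L p)) (smooth_numbers P)" for k :: nat
    unfolding h_def using has_sum_cmult_right[OF IH, of "F (p ^ k)"] by simp
  have cols: "((\<lambda>k. F (p ^ k) * (\<Prod>p\<in>P. L p)) has_sum (L p * (\<Prod>p\<in>P. L p))) UNIV"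
    using has_sum_cmult_left insert.prems(2)[of p] by blast
  \<comment> \<open>Since the terms are nonnegative, convergence of the iterated sum gives
    summability over the product set.\<close>
  have "h summable_on (UNIV \<times> smooth_numbers P)"
    using rows
  proof (rule summable_on_SigmaI)
    show "(\<lambda>k. F (p ^ k) * (\<Prod>p\<in>P. L p)) summable_on UNIV"
      using cols by (rule has_sum_imp_summable)
  qed (use nonneg ndvd prime_gt_0_nat[OF p] in \<open>auto simp: h_def\<close>)
  then have "(h has_sum (L p * (\<Prod>p\<in>P. L p))) (UNIV \<times> smooth_numbers P)"
    using rows cols by (intro has_sum_SigmaI)
  \<comment> \<open>Reindexing along \<open>p ^ k * m\<close>; the inverse splits off the full power
    of \<open>p\<close> by \<open>multiplicity\<close>.\<close>
  also have "?this \<longleftrightarrow> (F has_sum (\<Prod>p\<in>insert p P. L p)) (smooth_numbers (insert p P))"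
  proof (rule has_sum_reindex_bij_witness
      [where i = "\<lambda>n. (multiplicity p n, n div p ^ multiplicity p n)" and j = "\<lambda>(k, m). p ^ k * m"])
    fix a :: "nat \<times> nat" assume "a \<in> UNIV \<times> smooth_numbers P"
    then obtain k m where a: "a = (k, m)" and m: "m \<in> smooth_numbers P" by auto
    have "multiplicity p (p ^ k * m) = k"
      using ndvd[OF m] p by (intro multiplicity_decomposeI[of _ p k m]) auto
    then show "(multiplicity p (case a of (k, m) \<Rightarrow> p ^ k * m),
        (case a of (k, m) \<Rightarrow> p ^ k * m) div p ^ multiplicity p (case a of (k, m) \<Rightarrow> p ^ k * m)) = a"
      using prime_gt_0_nat[OF p] by (simp add: a)
    show "(case a of (k, m) \<Rightarrow> p ^ k * m) \<in> smooth_numbers (insert p P)"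
      using m p prime_gt_0_nat[OF p]
      by (auto simp: a smooth_numbers_def prime_factors_product prime_factorization_prime_power)
    show "F (case a of (k, m) \<Rightarrow> p ^ k * m) = h a"
      using mult[OF m] by (simp add: a h_def)
  next
    fix n assume n: "n \<in> smooth_numbers (insert p P)"
    then have n0: "n > 0" by (simp add: smooth_numbers_def)
    show "(case (multiplicity p n, n div p ^ multiplicity p n) of (k, m) \<Rightarrow> p ^ k * m) = n"
      by (simp add: multiplicity_dvd)
    have "\<not> p dvd n div p ^ multiplicity p n"
      using n0 p by (intro multiplicity_decompose) auto
    moreover have "n div p ^ multiplicity p n > 0"
      using n0 by (simp add: dvd_imp_le multiplicity_dvd div_greater_zero_iff prime_gt_0_nat[OF p])
    moreover have "n div p ^ multiplicity p n dvd n"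
      by (metis dvd_div_mult_self dvd_triv_left multiplicity_dvd)
    ultimately show "(multiplicity p n, n div p ^ multiplicity p n) \<in> UNIV \<times> smooth_numbers P"
      using n n0 by (auto simp: smooth_numbers_def prime_factors_dvd intro: dvd_trans)
  qed (use insert.hyps in simp)
  finally show ?case .
qed

text \<open>Powers of distinct primes are coprime, so one prime at a time can be split off. The
  inner claim has a free set of primes and free exponents so that the induction does not have to
  change \<open>n\<close>.\<close>

lemma multiplicative_prod_prime_powers:
  assumes F: "multiplicative F" and n: "n > 0"
  shows "F n = (\<Prod>p\<in>prime_factors n. F (p ^ multiplicity p n))"
proof -
  have "F (\<Prod>p\<in>P. p ^ e p) = (\<Prod>p\<in>P. F (p ^ e p))"
    if "finite P" "\<And>p. p \<in> P \<Longrightarrow> prime p" for P e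
    using that
  proof (induction P rule: finite_induct)
    case (insert p P)
    have "coprime (p ^ e p) (\<Prod>q\<in>P. q ^ e q)"
    proof (rule prod_coprime_right)
      fix q assume "q \<in> P"
      then have "coprime p q" using insert by (intro primes_coprime) auto
      then show "coprime (p ^ e p) (q ^ e q)" by simp
    qed
    moreover have "(\<Prod>q\<in>P. q ^ e q) > 0"
      using insert.prems by (intro prod_pos) (auto simp: prime_gt_0_nat)
    ultimately show ?case
      using insert prime_gt_0_nat[of p] by (simp add: multiplicative_coprime[OF F])
  qed (simp add: multiplicative_1[OF F, simplified])
  from this[of "prime_factors n" "\<lambda>p. multiplicity p n"] show ?thesis
    using n by (simp add: prime_factorization_nat[symmetric] in_prime_factors_imp_prime)
qed

text \<open>For coprime \<open>a\<close> and \<open>b\<close> the primes of the product form a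
  disjoint union, and each multiplicity is inherited from the side on which the prime
  occurs.\<close>

lemma multiplicative_prime_factors_prod:
  fixes G :: "nat \<Rightarrow> nat \<Rightarrow> real"
  shows "multiplicative (\<lambda>n. \<Prod>p\<in>prime_factors n. G p (multiplicity p n))"
  unfolding multiplicative_def
proof (intro conjI allI impI)
  fix a b :: nat assume ab: "a > 0" "b > 0" "coprime a b"
  have disj: "prime_factors a \<inter> prime_factors b = {}"
    using ab(3) by (auto simp: prime_factors_dvd dest: coprime_common_divisor not_prime_unit)
  have "multiplicity p (a * b) = multiplicity p a" if "p \<in> prime_factors a" for p
    using that ab disj by (subst prime_elem_multiplicity_mult_distrib)
      (auto simp: prime_factors_multiplicity)
  moreover have "multiplicity p (a * b) = multiplicity p b" if "p \<in> prime_factors b" for p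
    using that ab disj by (subst prime_elem_multiplicity_mult_distrib)
      (auto simp: prime_factors_multiplicity)
  ultimately show "(\<Prod>p\<in>prime_factors (a * b). G p (multiplicity p (a * b))) =
      (\<Prod>p\<in>prime_factors a. G p (multiplicity p a)) * (\<Prod>p\<in>prime_factors b. G p (multiplicity p b))"
    using ab disj by (simp add: prime_factors_product prod.union_disjoint)
qed simp

text \<open>Every finite set of positive integers consists of smooth numbers for some bound
  \<open>N\<close>, so a uniform bound on the finite Euler products bounds all finite partial
  sums.\<close>

lemma summable_on_euler_bound:
  assumes F: "multiplicative F" and nonneg: "\<And>n. n > 0 \<Longrightarrow> F n \<ge> 0"
    and L: "\<And>p. prime p \<Longrightarrow> ((\<lambda>k. F (p ^ k)) has_sum L p) UNIV"
    and B: "\<And>N. (\<Prod>p | prime p \<and> p \<le> N. L p) \<le> B"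
  shows "F summable_on {0<..}" "infsum F {0<..} \<le> B"
proof -
  have *: "sum F A \<le> B" if A: "finite A" "A \<subseteq> {0<..}" for A
  proof -
    define N where "N = Max (insert 0 A)"
    have "A \<subseteq> {0<..N}" using A by (auto simp: N_def)
    also note smooth_numbers_atMost
    finally have "A \<subseteq> smooth_numbers {p. prime p \<and> p \<le> N}" .
    then have "sum F A \<le> (\<Prod>p | prime p \<and> p \<le> N. L p)"
      using A by (intro finite_sum_le_has_sum[OF has_sum_euler_product[OF F nonneg]])
        (auto simp: L nonneg smooth_numbers_def)
    with B[of N] show ?thesis by simp
  qed
  show s: "F summable_on {0<..}"
    by (rule nonneg_bdd_above_summable_on) (auto simp: nonneg intro!: bdd_aboveI2 *)
  show "infsum F {0<..} \<le> B"
    using s * by (intro infsum_le_finite_sums) auto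
qed

text \<open>Squeeze: the finite product is a sum over smooth numbers, which lies between the partial
  sum up to \<open>N\<close> and the full sum \<open>S\<close>.\<close>

lemma euler_product_tendsto:
  assumes F: "multiplicative F" and nonneg: "\<And>n. n > 0 \<Longrightarrow> F n \<ge> 0"
    and L: "\<And>p. prime p \<Longrightarrow> ((\<lambda>k. F (p ^ k)) has_sum L p) UNIV"
    and S: "(F has_sum S) {0<..}"
  shows "(\<lambda>N. \<Prod>p | prime p \<and> p \<le> N. L p) \<longlonglongrightarrow> S"
proof (rule tendsto_sandwich)
  have E: "(F has_sum (\<Prod>p | prime p \<and> p \<le> N. L p)) (smooth_numbers {p. prime p \<and> p \<le> N})" for N
    by (rule has_sum_euler_product[OF F nonneg]) (auto simp: L)
  show "\<forall>\<^sub>F N in sequentially. (\<Sum>n\<in>{0<..N}. F n) \<le> (\<Prod>p | prime p \<and> p \<le> N. L p)"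
    using smooth_numbers_atMost
    by (intro always_eventually allI finite_sum_le_has_sum[OF E])
      (auto simp: smooth_numbers_def nonneg)
  show "\<forall>\<^sub>F N in sequentially. (\<Prod>p | prime p \<and> p \<le> N. L p) \<le> S"
    by (intro always_eventually allI has_sum_mono2[OF E S]) (auto simp: smooth_numbers_def nonneg)
  have "((\<lambda>n. F (Suc n)) has_sum S) UNIV"
    using S by (subst has_sum_reindex_bij_witness[where j = Suc and i = "\<lambda>n. n - 1" and T = "{0<..}" and h = F and s' = S]) auto
  then have "(\<lambda>n. F (Suc n)) sums S" by (rule has_sum_imp_sums)
  then have "(\<lambda>N. \<Sum>n<N. F (Suc n)) \<longlonglongrightarrow> S" by (simp add: sums_def)
  moreover have "(\<Sum>n<N. F (Suc n)) = (\<Sum>n\<in>{0<..N}. F n)" for N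
    by (rule sum.reindex_bij_witness[where j = Suc and i = "\<lambda>n. n - 1"]) auto
  ultimately show "(\<lambda>N. \<Sum>n\<in>{0<..N}. F n) \<longlonglongrightarrow> S" by simp
qed simp

section \<open>The Moebius transform\<close>

text \<open>For multiplicative \<open>F\<close> this is the Dirichlet convolution of \<open>F\<close> with the Moebius function;
  the value at \<open>0\<close> is the empty product \<open>1\<close>, so infinite sums must exclude \<open>0\<close>.\<close>

definition moebius_transform :: "(nat \<Rightarrow> real) \<Rightarrow> nat \<Rightarrow> real" where
  "moebius_transform F n =
     (\<Prod>p\<in>prime_factors n. F (p ^ multiplicity p n) - F (p ^ (multiplicity p n - 1)))"

lemma multiplicative_moebius_transform: "multiplicative (moebius_transform F)"
  unfolding moebius_transform_def[abs_def]
  by (rule multiplicative_prime_factors_prod[of "\<lambda>p k. F (p ^ k) - F (p ^ (k - 1))"])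

lemma moebius_transform_prime_power:
  assumes "prime p"
  shows "moebius_transform F (p ^ Suc k) = F (p ^ Suc k) - F (p ^ k)"
  using assms
  by (simp add: moebius_transform_def prime_factors_power prime_prime_factors del: power_Suc)

lemma moebius_transform_1: "moebius_transform F 1 = 1"
  by (simp add: moebius_transform_def)

lemma moebius_transform_nonneg:
  assumes "\<And>p k. prime p \<Longrightarrow> F (p ^ k) \<le> F (p ^ Suc k)"
  shows "moebius_transform F n \<ge> 0"
  unfolding moebius_transform_def
proof (rule prod_nonneg)
  fix p assume "p \<in> prime_factors n"
  then have "prime p" "multiplicity p n > 0" by (auto simp: prime_factors_multiplicity)
  then show "F (p ^ multiplicity p n) - F (p ^ (multiplicity p n - 1)) \<ge> 0"
    using assms[of p "multiplicity p n - 1"] by simp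
qed

lemma sum_divisors_moebius_transform:
  assumes F: "multiplicative F" and mono: "\<And>p k. prime p \<Longrightarrow> F (p ^ k) \<le> F (p ^ Suc k)"
    and n: "n > 0"
  shows "(\<Sum>d | d dvd n. moebius_transform F d) = F n"
proof -
  txt \<open>Restricting a multiplicative function to the divisors of \<open>n\<close> keeps it multiplicative, so the
    divisor sum is itself an Euler product, with telescoping local factors.\<close>
  define H where "H = (\<lambda>d. moebius_transform F d * (if d dvd n then 1 else 0))"
  have H: "multiplicative H" unfolding H_def
    by (intro multiplicative_times multiplicative_moebius_transform)
      (auto simp: multiplicative_def divides_mult dest: dvd_mult_left dvd_mult_right)
  have loc: "((\<lambda>k. H (p ^ k)) has_sum F (p ^ multiplicity p n)) UNIV" if p: "prime p" for p
  proof -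
    have tele: "(\<Sum>k\<le>m. moebius_transform F (p ^ k)) = F (p ^ m)" for m
    proof (induction m)
      case 0
      show ?case by (simp add: moebius_transform_1[simplified] multiplicative_1[OF F, simplified])
    next
      case (Suc m)
      then show ?case by (simp add: moebius_transform_prime_power[OF p] del: power_Suc)
    qed
    have dvd: "p ^ k dvd n \<longleftrightarrow> k \<le> multiplicity p n" for k
      using n p by (intro power_dvd_iff_le_multiplicity) auto
    have "(\<Sum>k\<le>multiplicity p n. H (p ^ k)) = F (p ^ multiplicity p n)"
      by (simp add: H_def dvd tele[symmetric])
    then have "((\<lambda>k. H (p ^ k)) has_sum F (p ^ multiplicity p n)) {..multiplicity p n}"
      by (intro has_sum_finiteI) auto
    also have "?this \<longleftrightarrow> ?thesis"
      by (intro has_sum_cong_neutral) (auto simp: H_def dvd)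
    finally show ?thesis .
  qed
  have "(H has_sum (\<Prod>p\<in>prime_factors n. F (p ^ multiplicity p n))) (smooth_numbers (prime_factors n))"
  proof (rule has_sum_euler_product[OF H])
    show "H d \<ge> 0" for d using moebius_transform_nonneg[of F, OF mono] by (simp add: H_def)
  qed (auto intro: loc)
  then have "(H has_sum F n) (smooth_numbers (prime_factors n))"
    using multiplicative_prod_prime_powers[OF F n] by simp
  \<comment> \<open>Every divisor of \<open>n\<close> is smooth over the prime factors of
    \<open>n\<close>; smooth numbers that do not divide \<open>n\<close> contribute 0 to
    \<open>H\<close>.\<close>
  also have "?this \<longleftrightarrow> (moebius_transform F has_sum F n) {d. d dvd n}"
  proof (rule has_sum_cong_neutral)
    fix d assume d: "d \<in> {d. d dvd n} - smooth_numbers (prime_factors n)"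
    then have "d > 0" using n by (auto intro: Nat.gr0I)
    then have False using d n dvd_prime_factors[of n d] by (auto simp: smooth_numbers_def)
    then show "moebius_transform F d = 0" ..
  qed (auto simp: H_def)
  moreover have "(moebius_transform F has_sum (\<Sum>d | d dvd n. moebius_transform F d)) {d. d dvd n}"
    using n by (intro has_sum_finite) simp
  ultimately show ?thesis using has_sum_unique by blast
qed

section \<open>Regular residues\<close>

lemma regular_mod_cong:
  assumes "[a = b] (mod int n)"
  shows "regular_mod a n \<longleftrightarrow> regular_mod b n"
proof -
  have "[a\<^sup>2 * x = b\<^sup>2 * x] (mod int n)" for x
    using assms by (intro cong_mult cong_pow cong_refl)
  then show ?thesis
    unfolding regular_mod_def using assms by (meson cong_sym cong_trans)
qed

text \<open>Chinese remainder theorem: the witnesses modulo \<open>m\<close> and modulo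
  \<open>n\<close> are glued to a single \<open>z\<close>.\<close>

lemma regular_mod_mult:
  assumes "coprime m n"
  shows "regular_mod a (m * n) \<longleftrightarrow> regular_mod a m \<and> regular_mod a n"
proof
  assume "regular_mod a (m * n)"
  then obtain x where "[a\<^sup>2 * x = a] (mod (int m * int n))" by (auto simp: regular_mod_def)
  then have "[a\<^sup>2 * x = a] (mod int m)" "[a\<^sup>2 * x = a] (mod int n)"
    by (rule cong_dvd_modulus, simp)+
  then show "regular_mod a m \<and> regular_mod a n" by (auto simp: regular_mod_def)
next
  assume "regular_mod a m \<and> regular_mod a n"
  then obtain x y where xy: "[a\<^sup>2 * x = a] (mod int m)" "[a\<^sup>2 * y = a] (mod int n)"
    by (auto simp: regular_mod_def)
  have co: "coprime (int m) (int n)" using assms by simp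
  then obtain z where z: "[z = x] (mod int m)" "[z = y] (mod int n)"
    using binary_chinese_remainder_int by blast
  have "[a\<^sup>2 * z = a] (mod int m)" "[a\<^sup>2 * z = a] (mod int n)"
    using xy z cong_mult[OF cong_refl] by (meson cong_trans)+
  then have "[a\<^sup>2 * z = a] (mod (int m * int n))"
    using co by (intro coprime_cong_mult)
  then show "regular_mod a (m * n)" by (auto simp: regular_mod_def)
qed

text \<open>Regularity says that \<open>p ^ k\<close> divides \<open>a * (a * x - 1)\<close>. If
  \<open>p\<close> divides \<open>a\<close>, it cannot divide the second factor, so the whole power
  falls on \<open>a\<close>. Conversely, an inverse is a witness for a unit, and 0 is a witness when
  \<open>p ^ k\<close> divides \<open>a\<close>.\<close>

lemma regular_mod_prime_power:
  assumes p: "prime p" and k: "k > 0"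
  shows "regular_mod (int a) (p ^ k) \<longleftrightarrow> \<not> p dvd a \<or> p ^ k dvd a"
proof
  assume "regular_mod (int a) (p ^ k)"
  then obtain x where x: "[(int a)\<^sup>2 * x = int a] (mod int (p ^ k))"
    by (auto simp: regular_mod_def)
  then have *: "int (p ^ k) dvd int a * (int a * x - 1)"
    by (simp add: cong_iff_dvd_diff power2_eq_square algebra_simps)
  show "\<not> p dvd a \<or> p ^ k dvd a"
  proof (cases "p dvd a")
    case True
    then have "int p dvd int a * x" by simp
    moreover have "\<not> int p dvd 1" using p by (metis not_prime_unit prime_int_nat_transfer prime_nat_int_transfer)
    ultimately have "\<not> int p dvd int a * x - 1" using dvd_diff_right_iff by blast
    then have "coprime (int p ^ k) (int a * x - 1)"
      using p by (intro coprime_power_left_iff[THEN iffD2]) (simp add: prime_imp_coprime)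
    then have "int (p ^ k) dvd int a"
      using * by (simp add: coprime_dvd_mult_left_iff)
    then show ?thesis by (simp only: int_dvd_int_iff) simp
  qed simp
next
  assume "\<not> p dvd a \<or> p ^ k dvd a"
  then show "regular_mod (int a) (p ^ k)"
  proof
    assume "\<not> p dvd a"
    then have "coprime p a" by (rule prime_imp_coprime[OF p])
    then have "coprime (int a) (int (p ^ k))" by (simp add: coprime_commute)
    then obtain y where "[int a * y = 1] (mod int (p ^ k))"
      using cong_solve_coprime_int by blast
    from cong_mult[OF cong_refl[of "int a"] this] show ?thesis
      by (auto simp: regular_mod_def power2_eq_square mult.assoc)
  next
    assume "p ^ k dvd a"
    then have "int (p ^ k) dvd int a" by (simp only: int_dvd_int_iff)
    then have "[(int a)\<^sup>2 * 0 = int a] (mod int (p ^ k))"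
      by (simp add: cong_iff_dvd_diff)
    then show ?thesis unfolding regular_mod_def by blast
  qed
qed

section \<open>Counting regular residues\<close>

definition regular_residues :: "nat \<Rightarrow> nat set" where
  "regular_residues n = {a. a < n \<and> regular_mod (int a) n}"

text \<open>Reduction modulo \<open>n\<close> only moves \<open>n\<close> to 0. The zero-based range
  suits \<open>mod\<close> and the Chinese remainder theorem.\<close>

lemma rho_eq_card_regular_residues:
  assumes "n > 0"
  shows "rho n = card (regular_residues n)"
proof -
  have n0: "regular_mod (int n) n \<longleftrightarrow> regular_mod 0 n"
    by (rule regular_mod_cong) (simp add: cong_def)
  have "bij_betw (\<lambda>a. nat a mod n) {a::int. 1 \<le> a \<and> a \<le> int n \<and> regular_mod a n} (regular_residues n)"
  proof (rule bij_betwI[where g = "\<lambda>a. if a = 0 then int n else int a"])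
    show "(\<lambda>a. nat a mod n) \<in> {a. 1 \<le> a \<and> a \<le> int n \<and> regular_mod a n} \<rightarrow> regular_residues n"
    proof
      fix a assume a: "a \<in> {a. 1 \<le> a \<and> a \<le> int n \<and> regular_mod a n}"
      then have "[int (nat a mod n) = a] (mod int n)" by (simp add: cong_def zmod_int)
      then show "nat a mod n \<in> regular_residues n"
        using a assms regular_mod_cong by (auto simp: regular_residues_def)
    qed
    fix a assume a: "a \<in> {a. 1 \<le> a \<and> a \<le> int n \<and> regular_mod a n}"
    show "(if nat a mod n = 0 then int n else int (nat a mod n)) = a"
    proof (cases "a = int n")
      case False
      then have "nat a < n" "nat a \<noteq> 0" using a by auto
      then show ?thesis using a by simp
    qed simp
  qed (use assms n0 in \<open>auto simp: regular_residues_def\<close>)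
  then show ?thesis unfolding rho_def by (rule bij_betw_same_card)
qed

text \<open>The map to the pair of residues is injective by coprimality, onto by the Chinese
  remainder theorem, and respects regularity by \<open>regular_mod_mult\<close>.\<close>

lemma rho_mult:
  assumes "m > 0" "n > 0" "coprime m n"
  shows "rho (m * n) = rho m * rho n"
proof -
  have reg: "regular_mod (int (x mod k)) k \<longleftrightarrow> regular_mod (int x) k" for x k
    by (rule regular_mod_cong) (simp add: cong_def zmod_int)
  have "bij_betw (\<lambda>x. (x mod m, x mod n)) (regular_residues (m * n))
          (regular_residues m \<times> regular_residues n)"
    unfolding bij_betw_def
  proof
    show "inj_on (\<lambda>x. (x mod m, x mod n)) (regular_residues (m * n))"
    proof (rule inj_onI)
      fix x y assume x: "x \<in> regular_residues (m * n)" and y: "y \<in> regular_residues (m * n)"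
        and "(x mod m, x mod n) = (y mod m, y mod n)"
      then have "[x = y] (mod m)" "[x = y] (mod n)" by (simp_all add: cong_def)
      then have "[x = y] (mod (m * n))" using assms(3) by (intro coprime_cong_mult_nat)
      then show "x = y" using x y by (simp add: cong_def regular_residues_def)
    qed
    show "(\<lambda>x. (x mod m, x mod n)) ` regular_residues (m * n) = regular_residues m \<times> regular_residues n"
    proof (intro equalityI subsetI)
      fix z assume "z \<in> (\<lambda>x. (x mod m, x mod n)) ` regular_residues (m * n)"
      then show "z \<in> regular_residues m \<times> regular_residues n"
        using assms reg by (auto simp: regular_residues_def regular_mod_mult)
    next
      fix z assume "z \<in> regular_residues m \<times> regular_residues n"
      then obtain a b where z: "z = (a, b)" and ab: "a < m" "b < n"
        "regular_mod (int a) m" "regular_mod (int b) n"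
        by (auto simp: regular_residues_def)
      obtain x where x: "x < m * n" "[x = a] (mod m)" "[x = b] (mod n)"
        using binary_chinese_remainder_unique_nat[OF assms(3), of a b] assms by auto
      then have *: "x mod m = a" "x mod n = b" using ab by (auto simp: cong_def)
      then have "x \<in> regular_residues (m * n)"
        using x(1) ab reg[of x m] reg[of x n] assms(3) by (simp add: regular_residues_def regular_mod_mult)
      with * show "z \<in> (\<lambda>x. (x mod m, x mod n)) ` regular_residues (m * n)" by (force simp: z)
    qed
  qed
  then have "card (regular_residues (m * n)) = card (regular_residues m \<times> regular_residues n)"
    by (rule bij_betw_same_card)
  then show ?thesis using assms by (simp add: rho_eq_card_regular_residues card_cartesian_product)
qed

text \<open>The regular residues modulo a prime power are 0 and the units, so the count is one more
  than Euler's totient.\<close>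

lemma rho_prime_power:
  assumes p: "prime p"
  shows "rho (p ^ Suc k) = p ^ k * (p - 1) + 1"
proof -
  have "regular_residues (p ^ Suc k) = insert 0 (totatives (p ^ Suc k))"
  proof (intro equalityI subsetI)
    fix a assume "a \<in> regular_residues (p ^ Suc k)"
    then have a: "a < p ^ Suc k" "\<not> p dvd a \<or> p ^ Suc k dvd a"
      using regular_mod_prime_power[OF p, of "Suc k" a] by (auto simp: regular_residues_def)
    show "a \<in> insert 0 (totatives (p ^ Suc k))"
    proof (cases "a = 0")
      case False
      then have "\<not> p dvd a" using a dvd_imp_le[of "p ^ Suc k" a] by auto
      then have "coprime p a" by (rule prime_imp_coprime[OF p])
      then have "coprime a (p ^ Suc k)" by (simp add: coprime_commute)
      then show ?thesis using a(1) False by (simp add: in_totatives_iff del: power_Suc)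
    qed simp
  next
    fix a assume a: "a \<in> insert 0 (totatives (p ^ Suc k))"
    have "a < p ^ Suc k"
    proof (cases "a = 0")
      case False
      then have "a \<in> totatives (p ^ Suc k)" using a by blast
      \<comment> \<open>\<open>totatives n\<close> is a subset of \<open>{0<..n}\<close>; it omits
        \<open>n\<close> itself only when \<open>n > 1\<close>.\<close>
      moreover have "p ^ Suc k > 1" using prime_gt_1_nat[OF p] by (intro one_less_power) auto
      ultimately show ?thesis by (rule totatives_less)
    qed (use prime_gt_0_nat[OF p] in simp)
    moreover have "a = 0 \<or> \<not> p dvd a"
    proof (cases "a = 0")
      case False
      then have "coprime a p" using a by (auto simp: in_totatives_iff)
      then show ?thesis using p by (metis coprime_absorb_right not_prime_unit)
    qed simp
    ultimately show "a \<in> regular_residues (p ^ Suc k)"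
      using regular_mod_prime_power[OF p, of "Suc k" a] by (auto simp: regular_residues_def)
  qed
  then have "card (regular_residues (p ^ Suc k)) = Suc (totient (p ^ Suc k))"
    by (simp add: totient_def)
  then show ?thesis
    using prime_gt_0_nat[OF p]
    by (subst rho_eq_card_regular_residues) (simp_all add: totient_prime_power_Suc[OF p] del: power_Suc)
qed

lemma rho_1: "rho 1 = 1"
proof -
  have "regular_residues 1 = {0}" by (auto simp: regular_residues_def regular_mod_def)
  then show ?thesis using rho_eq_card_regular_residues[of 1] by simp
qed

section \<open>The quotient n / rho(n) and its Moebius transform\<close>

lemma multiplicative_n_div_rho: "multiplicative (\<lambda>n. real n / real (rho n))"
  by (simp add: multiplicative_def rho_mult rho_1[simplified])

text \<open>The function g of the overview.\<close>

definition rho_coeff :: "nat \<Rightarrow> real" where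
  "rho_coeff = moebius_transform (\<lambda>n. real n / real (rho n))"

text \<open>This form confines the dependence on \<open>k\<close> to one small term, which makes
  differences of consecutive values easy to bound.\<close>

lemma prime_power_div_rho:
  assumes "prime p"
  shows "real (p ^ Suc k) / real (rho (p ^ Suc k)) = 1 / (1 - 1 / real p + 1 / real p ^ Suc k)"
proof -
  have "real p > 0" using prime_gt_0_nat[OF assms] by simp
  then have "1 - 1 / real p + 1 / real p ^ Suc k = (real p ^ k * (real p - 1) + 1) / real p ^ Suc k"
    by (simp add: field_simps)
  also have "real p ^ k * (real p - 1) + 1 = real (rho (p ^ Suc k))"
    using prime_gt_0_nat[OF assms] by (subst rho_prime_power[OF assms]) simp
  finally show ?thesis by simp
qed

text \<open>With a = 1 - 1/p and q = p^-(k+1), the difference of consecutive values is q a / ((a +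
  q/p)(a + q)), which is at most q/a <= 2q. For \<open>k = 0\<close>, a + q = 1 improves the
  constant to 1; this lets a single Euler factor of zeta(1 + e) absorb the term at p^2.\<close>

lemma rho_coeff_prime_power_ge_2:
  assumes p: "prime p"
  shows "rho_coeff (p ^ Suc (Suc k)) \<ge> 0"
    and "rho_coeff (p ^ Suc (Suc k)) \<le> (if k = 0 then 1 else 2) / real p ^ Suc k"
proof -
  define P where "P = real p"
  have P: "P \<ge> 2" using prime_ge_2_nat[OF p] by (simp add: P_def)
  define a where "a = 1 - 1 / P"
  define q where "q = 1 / P ^ Suc k"
  have a: "a \<ge> 1 / 2" "a < 1" and q: "q > 0" using P by (auto simp: a_def q_def field_simps)
  have eq: "rho_coeff (p ^ Suc (Suc k)) = 1 / (a + q / P) - 1 / (a + q)"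
    unfolding rho_coeff_def moebius_transform_prime_power[OF p] prime_power_div_rho[OF p]
    by (simp add: a_def q_def P_def)
  also have "\<dots> = q * a / ((a + q / P) * (a + q))"
  proof -
    have "a + q / P > 0" "a + q > 0" using a q P by (auto intro!: add_pos_pos)
    then have "1 / (a + q / P) - 1 / (a + q) = (q - q / P) / ((a + q / P) * (a + q))"
      by (simp add: field_simps)
    moreover have "q - q / P = q * a" by (simp add: a_def field_simps)
    ultimately show ?thesis by simp
  qed
  finally have eq': "rho_coeff (p ^ Suc (Suc k)) = q * a / ((a + q / P) * (a + q))" .
  show "rho_coeff (p ^ Suc (Suc k)) \<ge> 0" unfolding eq' using a q P by simp
  have "rho_coeff (p ^ Suc (Suc k)) \<le> q * (if k = 0 then 1 else 2)"
  proof (cases "k = 0")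
    case True
    then have "a + q = 1" using P by (simp add: a_def q_def)
    then have "rho_coeff (p ^ Suc (Suc k)) = q * (a / (a + q / P))" by (simp add: eq' del: power_Suc)
    also have "q / P \<ge> 0" using q P by simp
    then have "q * (a / (a + q / P)) \<le> q * 1"
      using a q by (intro mult_left_mono) (auto simp: divide_le_eq)
    finally show ?thesis using True by simp
  next
    case False
    have "a + q / P > 0" "a + q > 0" using a q P by (auto intro!: add_pos_pos)
    then have "a / ((a + q / P) * (a + q)) \<le> a / (a * a)"
      using a q P by (intro divide_left_mono mult_mono mult_pos_pos) auto
    also have "\<dots> \<le> 2" using a by (simp add: field_simps)
    finally have "q * (a / ((a + q / P) * (a + q))) \<le> q * 2" using q by (intro mult_left_mono) auto
    then show ?thesis using False by (simp add: eq' del: power_Suc)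
  qed
  then show "rho_coeff (p ^ Suc (Suc k)) \<le> (if k = 0 then 1 else 2) / real p ^ Suc k"
    by (simp add: q_def P_def)
qed

lemma rho_coeff_prime:
  assumes p: "prime p"
  shows "rho_coeff p = 0"
proof -
  have "real p / real (rho p) = 1" using prime_power_div_rho[OF p, of 0] prime_gt_0_nat[OF p] by simp
  then show ?thesis
    using moebius_transform_prime_power[OF p, of _ 0] rho_1 by (simp add: rho_coeff_def)
qed

lemma prime_power_div_rho_mono:
  assumes p: "prime p"
  shows "real (p ^ k) / real (rho (p ^ k)) \<le> real (p ^ Suc k) / real (rho (p ^ Suc k))"
proof -
  have "rho_coeff (p ^ Suc k) \<ge> 0"
    using rho_coeff_prime_power_ge_2(1)[OF p] rho_coeff_prime[OF p] by (cases k) auto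
  then show ?thesis unfolding rho_coeff_def moebius_transform_prime_power[OF p] by simp
qed

lemma rho_coeff_nonneg: "rho_coeff n \<ge> 0"
  unfolding rho_coeff_def using prime_power_div_rho_mono by (intro moebius_transform_nonneg)

lemma multiplicative_rho_coeff: "multiplicative rho_coeff"
  unfolding rho_coeff_def by (rule multiplicative_moebius_transform)

lemma sum_divisors_rho_coeff:
  assumes "n > 0"
  shows "(\<Sum>d | d dvd n. rho_coeff d) = real n / real (rho n)"
  unfolding rho_coeff_def
  by (rule sum_divisors_moebius_transform[OF multiplicative_n_div_rho prime_power_div_rho_mono assms])

section \<open>The Dirichlet series of the coefficients\<close>

text \<open>Discrete integral comparison: s (N+1)^-(1+s) is at most N^-s - (N+1)^-s, and these
  differences telescope.\<close>

lemma sum_powr_le: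
  assumes s: "s > 0" and A: "finite A" "A \<subseteq> {0<..}"
  shows "(\<Sum>n\<in>A. real n powr -(1 + s)) \<le> 1 + 1 / s"
proof -
  have step: "s * real (Suc N) powr -(1 + s) \<le> real N powr -s - real (Suc N) powr -s" if "N > 0" for N
  proof -
    have pos: "real N > 0" "real (Suc N) > 0" using that by auto
    \<comment> \<open>\<open>ln u <= u - 1\<close> bounds ln(N+1) - ln N below by 1/(N+1); then
      \<open>1 + v <= exp v\<close> carries this over to the powers.\<close>
    have "ln (real N / real (Suc N)) \<le> real N / real (Suc N) - 1"
      using pos by (intro ln_le_minus_one) auto
    then have "1 / real (Suc N) \<le> ln (real (Suc N)) - ln (real N)"
      using pos by (simp add: ln_div field_simps)
    then have "s * (1 / real (Suc N)) \<le> s * (ln (real (Suc N)) - ln (real N))"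
      using s by (intro mult_left_mono) auto
    also have "\<dots> \<le> exp (s * (ln (real (Suc N)) - ln (real N))) - 1"
      using exp_ge_add_one_self[of "s * (ln (real (Suc N)) - ln (real N))"] by linarith
    finally have "real (Suc N) powr -s * (s * (1 / real (Suc N))) \<le>
        real (Suc N) powr -s * (exp (s * (ln (real (Suc N)) - ln (real N))) - 1)"
      by (intro mult_left_mono) auto
    also have "\<dots> = real N powr -s - real (Suc N) powr -s"
      using pos by (simp add: powr_def exp_add[symmetric] exp_diff[symmetric] algebra_simps)
    also have "real (Suc N) powr -s * (s * (1 / real (Suc N))) = s * real (Suc N) powr -(1 + s)"
      using pos by (simp add: powr_diff powr_minus divide_inverse mult_ac)
    finally show ?thesis .
  qed
  have bound: "(\<Sum>n\<in>{0<..Suc N}. real n powr -(1 + s)) \<le> 1 + (1 - real (Suc N) powr -s) / s" for N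
  proof (induction N)
    case 0
    have "{0<..Suc 0} = {1}" by auto
    then show ?case by simp
  next
    case (Suc N)
    have "real (Suc (Suc N)) powr -(1 + s) \<le> (real (Suc N) powr -s - real (Suc (Suc N)) powr -s) / s"
      using step[of "Suc N"] s by (simp add: pos_le_divide_eq mult.commute)
    moreover have "{0<..Suc (Suc N)} = insert (Suc (Suc N)) {0<..Suc N}" by auto
    ultimately show ?case using Suc.IH by (simp add: diff_divide_distrib)
  qed
  define N where "N = Max (insert 0 A)"
  have "A \<subseteq> {0<..Suc N}" using A by (auto simp: N_def le_Suc_eq)
  then have "(\<Sum>n\<in>A. real n powr -(1 + s)) \<le> (\<Sum>n\<in>{0<..Suc N}. real n powr -(1 + s))"
    by (intro sum_mono2) auto
  also note bound
  also have "1 + (1 - real (Suc N) powr -s) / s \<le> 1 + 1 / s"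
    using s by (simp add: divide_right_mono)
  finally show ?thesis .
qed

lemma has_sum_powr_prime_powers:
  assumes "prime p" "t < 0"
  shows "((\<lambda>k. real (p ^ k) powr t) has_sum (1 / (1 - real p powr t))) UNIV"
proof -
  have "real p > 1" using prime_gt_1_nat[OF assms(1)] by simp
  then have "\<bar>real p powr t\<bar> < 1" using powr_less_mono[of t 0 "real p"] assms(2) by simp
  moreover have "real (p ^ k) powr t = (real p powr t) ^ k" for k
    using \<open>real p > 1\<close> by (simp add: powr_powr powr_realpow[symmetric] mult.commute)
  ultimately show ?thesis
    using geometric_sums[of "real p powr t"] by (intro sums_nonneg_imp_has_sum) simp_all
qed

text \<open>The finite product is a sum of n^-(1+s) over smooth numbers, so
  \<open>sum_powr_le\<close> bounds it uniformly in \<open>N\<close>.\<close>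

lemma prod_primes_powr_le:
  assumes s: "s > 0"
  shows "(\<Prod>p | prime p \<and> p \<le> N. 1 / (1 - real p powr -(1 + s))) \<le> 1 + 1 / s"
proof (rule has_sum_le_finite_sums)
  show "((\<lambda>n. real n powr -(1 + s)) has_sum
      (\<Prod>p | prime p \<and> p \<le> N. 1 / (1 - real p powr -(1 + s)))) (smooth_numbers {p. prime p \<and> p \<le> N})"
    using s by (intro has_sum_euler_product multiplicative_powr has_sum_powr_prime_powers) auto
  show "(\<Sum>n\<in>A. real n powr -(1 + s)) \<le> 1 + 1 / s"
    if "finite A" "A \<subseteq> smooth_numbers {p. prime p \<and> p \<le> N}" for A
    using that s by (intro sum_powr_le) (auto simp: smooth_numbers_def)
qed

text \<open>From \<open>1 + u <= exp u\<close>: the exponent is 4 times a sum of p^-2, which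
  \<open>sum_powr_le\<close> with \<open>s = 1\<close> bounds by 2.\<close>

lemma prod_primes_square_le: "(\<Prod>p | prime p \<and> p \<le> N. 1 + 4 / (real p)\<^sup>2) \<le> exp 8"
proof -
  have "(\<Prod>p | prime p \<and> p \<le> N. 1 + 4 / (real p)\<^sup>2) \<le> (\<Prod>p | prime p \<and> p \<le> N. exp (4 / (real p)\<^sup>2))"
    by (intro prod_mono) (auto intro!: add_nonneg_nonneg)
  also have "\<dots> = exp (\<Sum>p | prime p \<and> p \<le> N. 4 / (real p)\<^sup>2)"
    by (simp add: exp_sum)
  also have "(\<Sum>p | prime p \<and> p \<le> N. 4 / (real p)\<^sup>2) = 4 * (\<Sum>p | prime p \<and> p \<le> N. real p powr -(1 + 1))"
    unfolding sum_distrib_left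
    by (intro sum.cong refl) (auto simp: powr_minus divide_inverse prime_gt_0_nat powr_numeral)
  also have "\<dots> \<le> 4 * (1 + 1 / 1)"
    by (intro mult_left_mono sum_powr_le) (auto simp: prime_gt_0_nat)
  finally show ?thesis by simp
qed

text \<open>Put y = p^-(1+e). The terms at k = 0, 1, 2 are 1, 0 and at most y, and the later ones
  sum to at most 4/p^2. Then 1 + y + 4/p^2 <= (1 + 4/p^2)(1 + y), and 1 + y is at most 1/(1 - y),
  the Euler factor of zeta(1 + e).\<close>

lemma rho_coeff_powr_local_factor:
  assumes p: "prime p" and e: "e > 0"
  obtains L where "((\<lambda>k. rho_coeff (p ^ k) * real (p ^ k) powr -e) has_sum L) UNIV"
    and "0 \<le> L" and "L \<le> (1 + 4 / (real p)\<^sup>2) * (1 / (1 - real p powr -(1 + e)))"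
proof -
  define P where "P = real p"
  have P: "P \<ge> 2" using prime_ge_2_nat[OF p] by (simp add: P_def)
  define y where "y = P powr -(1 + e)"
  have y: "y > 0" "y < 1" using P e powr_less_mono[of "-(1 + e)" 0 P] by (auto simp: y_def)
  define t where "t = (\<lambda>k. rho_coeff (p ^ k) * real (p ^ k) powr -e)"
  have t0: "t k \<ge> 0" for k by (simp add: t_def rho_coeff_nonneg)
  have le1: "real (p ^ k) powr -e \<le> 1" for k
    using powr_mono[of "-e" 0 "real (p ^ k)"] prime_gt_0_nat[OF p] e by (simp add: Suc_le_eq)
  \<comment> \<open>The power with exponent \<open>-e\<close> is bounded by 1: the decay of the
    coefficients alone makes the tail O(p^-2), uniformly in \<open>e\<close>.\<close>
  have tail: "t (k + 3) \<le> 2 / P\<^sup>2 * (1 / P) ^ k" for k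
  proof -
    have "t (k + 3) \<le> rho_coeff (p ^ Suc (Suc (Suc k))) * 1"
      unfolding t_def using le1[of "k + 3"]
      by (intro mult_mono) (simp_all add: rho_coeff_nonneg numeral_3_eq_3)
    also have "\<dots> \<le> 2 / P ^ Suc (Suc k)"
      using rho_coeff_prime_power_ge_2(2)[OF p, of "Suc k"] by (simp add: P_def)
    finally show ?thesis by (simp add: power2_eq_square power_one_over mult_ac)
  qed
  have "(\<lambda>k. (1 / P) ^ k) sums (1 / (1 - 1 / P))"
    using P by (intro geometric_sums) auto
  then have geo: "(\<lambda>k. 2 / P\<^sup>2 * (1 / P) ^ k) sums (2 / P\<^sup>2 * (1 / (1 - 1 / P)))"
    by (rule sums_mult)
  have summ: "summable (\<lambda>k. t (k + 3))"
    by (rule summable_comparison_test'[OF sums_summable[OF geo]]) (use tail t0 in auto)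
  have "(\<Sum>k. t (k + 3)) \<le> 2 / P\<^sup>2 * (1 / (1 - 1 / P))"
    using suminf_le[OF tail summ sums_summable[OF geo]] sums_unique[OF geo] by simp
  also have "\<dots> \<le> 2 / P\<^sup>2 * 2"
    using P by (intro mult_left_mono) (auto simp: field_simps)
  finally have tail_sum: "(\<Sum>k. t (k + 3)) \<le> 4 / P\<^sup>2" by simp
  have t_summ: "summable t" using summ by (simp only: summable_iff_shift)
  have "t 2 \<le> y"
  proof -
    have "rho_coeff (p ^ 2) \<le> 1 / P"
      using rho_coeff_prime_power_ge_2(2)[OF p, of 0] by (simp add: P_def power2_eq_square)
    \<comment> \<open>Weakening p^(-2e) to p^-e makes the bound for \<open>t 2\<close> exactly
      \<open>y\<close>.\<close>
    moreover have "real (p ^ 2) powr -e \<le> P powr -e"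
      using P e by (intro powr_mono2') (auto simp: P_def power2_eq_square)
    ultimately have "t 2 \<le> 1 / P * P powr -e"
      unfolding t_def using P by (intro mult_mono) (auto simp: rho_coeff_nonneg)
    also have "\<dots> = y" using P by (simp add: y_def powr_diff powr_minus divide_inverse mult_ac)
    finally show ?thesis .
  qed
  moreover have "t 0 = 1" "t 1 = 0"
    using rho_coeff_prime[OF p] prime_gt_0_nat[OF p]
    by (simp_all add: t_def multiplicative_1[OF multiplicative_rho_coeff, simplified])
  moreover have "(\<Sum>k. t k) = (\<Sum>k. t (k + 3)) + (t 0 + t 1 + t 2)"
    using suminf_split_initial_segment[OF t_summ, of 3] by (simp add: numeral_3_eq_3 numeral_2_eq_2)
  ultimately have "(\<Sum>k. t k) \<le> 1 + y + 4 / P\<^sup>2" using tail_sum by linarith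
  also have "\<dots> \<le> (1 + 4 / P\<^sup>2) * (1 + y)"
    using y mult_nonneg_nonneg[of y "4 / P\<^sup>2"] by (simp add: distrib_right distrib_left)
  also have "\<dots> \<le> (1 + 4 / P\<^sup>2) * (1 / (1 - y))"
  proof (intro mult_left_mono)
    have "(1 + y) * (1 - y) \<le> 1" by (simp add: algebra_simps)
    then show "1 + y \<le> 1 / (1 - y)" using y by (simp add: pos_le_divide_eq)
  qed (auto intro!: add_nonneg_nonneg)
  finally have "(\<Sum>k. t k) \<le> (1 + 4 / P\<^sup>2) * (1 / (1 - y))" .
  moreover have "(t has_sum (\<Sum>k. t k)) UNIV"
    using t_summ t0 by (intro sums_nonneg_imp_has_sum summable_sums)
  moreover have "(\<Sum>k. t k) \<ge> 0" using t_summ t0 by (rule suminf_nonneg)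
  ultimately show ?thesis using that[of "\<Sum>k. t k"] by (simp add: t_def y_def P_def)
qed

text \<open>Multiplying the local bounds compares the series with a constant times zeta(1 + e). The
  dependence on \<open>e\<close> is kept explicit because \<open>e\<close> will shrink as
  \<open>x\<close> grows.\<close>

lemma rho_coeff_powr_summable:
  assumes e: "e > 0"
  shows "(\<lambda>d. rho_coeff d * real d powr -e) summable_on {0<..}"
    and "infsum (\<lambda>d. rho_coeff d * real d powr -e) {0<..} \<le> exp 8 * (1 + 1 / e)"
proof -
  define L where "L = (\<lambda>p. \<Sum>\<^sub>\<infinity>k. rho_coeff (p ^ k) * real (p ^ k) powr -e)"
  have L: "((\<lambda>k. rho_coeff (p ^ k) * real (p ^ k) powr -e) has_sum L p) UNIV"
    "0 \<le> L p" "L p \<le> (1 + 4 / (real p)\<^sup>2) * (1 / (1 - real p powr -(1 + e)))" if p: "prime p" for p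
  proof -
    obtain l where l: "((\<lambda>k. rho_coeff (p ^ k) * real (p ^ k) powr -e) has_sum l) UNIV"
      "0 \<le> l" "l \<le> (1 + 4 / (real p)\<^sup>2) * (1 / (1 - real p powr -(1 + e)))"
      using rho_coeff_powr_local_factor[OF p e] by blast
    moreover have "L p = l" unfolding L_def using l(1) by (rule infsumI)
    ultimately show "((\<lambda>k. rho_coeff (p ^ k) * real (p ^ k) powr -e) has_sum L p) UNIV"
      "0 \<le> L p" "L p \<le> (1 + 4 / (real p)\<^sup>2) * (1 / (1 - real p powr -(1 + e)))"
      by simp_all
  qed
  have B: "(\<Prod>p | prime p \<and> p \<le> N. L p) \<le> exp 8 * (1 + 1 / e)" for N
  proof -
    have fin: "1 / (1 - real p powr -(1 + e)) \<ge> 0" if "prime p" for p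
      using prime_gt_1_nat[OF that] powr_mono[of "-(1 + e)" 0 "real p"] e by simp
    have "(\<Prod>p | prime p \<and> p \<le> N. L p) \<le>
        (\<Prod>p | prime p \<and> p \<le> N. (1 + 4 / (real p)\<^sup>2) * (1 / (1 - real p powr -(1 + e))))"
      using L by (intro prod_mono) auto
    also have "\<dots> = (\<Prod>p | prime p \<and> p \<le> N. 1 + 4 / (real p)\<^sup>2) *
        (\<Prod>p | prime p \<and> p \<le> N. 1 / (1 - real p powr -(1 + e)))"
      by (rule prod.distrib)
    also have "\<dots> \<le> exp 8 * (1 + 1 / e)"
      using prod_primes_square_le prod_primes_powr_le[OF e] fin
      by (intro mult_mono) (auto intro!: prod_nonneg)
    finally show ?thesis .
  qed
  have "multiplicative (\<lambda>d. rho_coeff d * real d powr -e)"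
    by (intro multiplicative_times multiplicative_rho_coeff multiplicative_powr)
  note this rho_coeff_nonneg L(1) B
  then show "(\<lambda>d. rho_coeff d * real d powr -e) summable_on {0<..}"
    and "infsum (\<lambda>d. rho_coeff d * real d powr -e) {0<..} \<le> exp 8 * (1 + 1 / e)"
    using summable_on_euler_bound[of "\<lambda>d. rho_coeff d * real d powr -e" L "exp 8 * (1 + 1 / e)"]
    by (simp_all add: rho_coeff_nonneg)
qed

section \<open>The leading constant\<close>

lemma zeta_has_sum:
  assumes "s > 1"
  shows "((\<lambda>n. real n powr -s) has_sum zeta s) {0<..}"
proof -
  have "((\<lambda>n. real (Suc n) powr -s) has_sum zeta s) UNIV"
    using summable_sums[OF summable_zeta[OF assms]]
    by (intro sums_nonneg_imp_has_sum) (simp_all add: zeta_def powr_minus_divide)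
  also have "?this \<longleftrightarrow> ?thesis"
    by (rule has_sum_reindex_bij_witness[where j = Suc and i = "\<lambda>n. n - 1"]) auto
  finally show ?thesis .
qed

lemma zeta_euler_product:
  assumes "s > 1"
  shows "(\<lambda>N. \<Prod>p | prime p \<and> p \<le> N. 1 / (1 - real p powr -s)) \<longlonglongrightarrow> zeta s"
proof (rule euler_product_tendsto[where F = "\<lambda>n. real n powr -s"])
  show "((\<lambda>k. real (p ^ k) powr -s) has_sum 1 / (1 - real p powr -s)) UNIV" if "prime p" for p
    using that assms by (intro has_sum_powr_prime_powers) auto
qed (use assms in \<open>auto intro: multiplicative_powr zeta_has_sum\<close>)

lemma zeta_pos:
  assumes "s > 1"
  shows "zeta s > 0"
  unfolding zeta_def using assms by (intro suminf_pos summable_zeta) auto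

text \<open>Partial fractions for 1 / (A (A - A/p + 1)) with A = p^(k+1); this relates the inner
  series of \<open>D_const\<close> to the reciprocals of \<open>rho\<close> at powers of
  \<open>p\<close>.\<close>

lemma local_term_eq:
  assumes p: "prime p"
  shows "local_term p k = (1 / real p) ^ Suc k - (1 - 1 / real p) / real (rho (p ^ Suc k))"
proof -
  define P where "P = real p"
  define q where "q = P ^ k"
  have P: "P > 1" using prime_gt_1_nat[OF p] by (simp add: P_def)
  have q: "q > 0" using P by (simp add: q_def)
  have rho: "real (rho (p ^ Suc k)) = P * q - q + 1"
    using prime_gt_0_nat[OF p] by (subst rho_prime_power[OF p]) (simp add: P_def q_def algebra_simps)
  have "1 * q \<le> P * q" using P q by (intro mult_right_mono) auto
  then have "P * q - q + 1 > 0" by linarith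
  then have "1 / (P * q * (P * q - q + 1)) = 1 / (P * q) - (1 - 1 / P) / (P * q - q + 1)"
    using P q by (simp add: divide_simps) (simp add: algebra_simps)
  then show ?thesis unfolding rho local_term_def by (simp add: P_def q_def power_one_over)
qed

text \<open>With v(k) = 1/rho(p^k), the term at k + 1 is v(k+1) - v(k)/p. If V denotes the sum of
  v(k) over k >= 1, the whole series is therefore (1 + V)(1 - 1/p).\<close>

lemma rho_coeff_local_factor:
  assumes p: "prime p"
  shows "((\<lambda>k. rho_coeff (p ^ k) / real (p ^ k)) has_sum
    1 / (1 - real p powr -2) * (1 / (1 - real p powr -3)) / (1 / (1 - real p powr -6)) * local_factor p) UNIV"
proof -
  define P where "P = real p"
  have P: "P > 1" using prime_gt_1_nat[OF p] by (simp add: P_def)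
  define v where "v = (\<lambda>k. 1 / real (rho (p ^ k)))"
  define T where "T = (\<Sum>k. local_term p k)"
  \<comment> \<open>The sum of 1/rho(p^nu) over nu >= 1, found by summing
    \<open>local_term_eq\<close> over \<open>k\<close> and solving.\<close>
  define V where "V = (1 / (P - 1) - T) / (1 - 1 / P)"
  have T: "local_term p sums T"
    using summable_local_term[OF prime_ge_2_nat[OF p]] by (simp add: T_def summable_sums)
  have "(\<lambda>k. (1 / P) * (1 / P) ^ k) sums (1 / P * (1 / (1 - 1 / P)))"
    using P by (intro sums_mult geometric_sums) auto
  also have "1 / P * (1 / (1 - 1 / P)) = 1 / (P - 1)" using P by (simp add: field_simps)
  finally have "(\<lambda>k. ((1 / P) * (1 / P) ^ k - local_term p k) / (1 - 1 / P)) sums V"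
    unfolding V_def using T by (intro sums_divide sums_diff)
  moreover have "((1 / P) * (1 / P) ^ k - local_term p k) / (1 - 1 / P) = v (Suc k)" for k
    using P by (simp add: local_term_eq[OF p] v_def P_def)
  ultimately have v: "(\<lambda>k. v (Suc k)) sums V" by simp
  then have "v sums (1 + V)"
    using sums_Suc_iff[of v V] rho_1 by (simp add: v_def add.commute)
  with v have "(\<lambda>k. v (Suc k) - v k / P) sums (V - (1 + V) / P)"
    by (intro sums_diff sums_divide)
  moreover have "v (Suc k) - v k / P = rho_coeff (p ^ Suc k) / real (p ^ Suc k)" for k
    using P unfolding rho_coeff_def moebius_transform_prime_power[OF p]
    by (simp add: v_def P_def diff_divide_distrib)
  ultimately have "(\<lambda>k. rho_coeff (p ^ Suc k) / real (p ^ Suc k)) sums (V - (1 + V) / P)"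
    by (simp only:)
  then have "(\<lambda>k. rho_coeff (p ^ k) / real (p ^ k)) sums (V - (1 + V) / P + 1)"
    using sums_Suc_iff[of "\<lambda>k. rho_coeff (p ^ k) / real (p ^ k)"]
    by (simp add: multiplicative_1[OF multiplicative_rho_coeff, simplified])
  also have "V - (1 + V) / P + 1 = (P\<^sup>2 - P + 1) / (P * (P - 1)) - T"
  proof -
    have "V - (1 + V) / P + 1 = V * (1 - 1 / P) + (1 - 1 / P)"
      by (simp add: algebra_simps add_divide_distrib)
    also have "\<dots> = 1 / (P - 1) - T + (1 - 1 / P)" using P by (simp add: V_def)
    also have "\<dots> = (P\<^sup>2 - P + 1) / (P * (P - 1)) - T"
      using P by (simp add: divide_simps) (simp add: power2_eq_square algebra_simps)
    finally show ?thesis .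
  qed
  also have "\<dots> = (P\<^sup>2 - P + 1) / (P * (P - 1)) * local_factor p"
  proof -
    have "P * (P - 1) > 0" using P by simp
    moreover have "P\<^sup>2 - P + 1 > 0"
      using \<open>P * (P - 1) > 0\<close> by (simp add: power2_eq_square algebra_simps)
    ultimately show ?thesis using P
      unfolding local_factor_def T_def[symmetric] P_def[symmetric] by (simp add: right_diff_distrib)
  qed
  \<comment> \<open>The Euler factor of zeta(2) zeta(3) / zeta(6): 1 - p^-6 = (1 - p^-3)(1 + p^-3),
    and 1 + p^-3 = (1 + 1/p)(1 - 1/p + 1/p^2).\<close>
  also have "(P\<^sup>2 - P + 1) / (P * (P - 1)) =
      1 / (1 - P powr -2) * (1 / (1 - P powr -3)) / (1 / (1 - P powr -6))"
  proof -
    have pw: "P powr -2 = 1 / P ^ 2" "P powr -3 = 1 / P ^ 3" "P powr -6 = 1 / P ^ 6"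
      using P by (simp_all add: powr_minus divide_inverse powr_numeral)
    have "P * P > 1" using P by (intro less_1_mult)
    moreover have "P * (P * P) > 1" using P calculation by (intro less_1_mult)
    ultimately show ?thesis unfolding pw using P
      by (simp add: divide_simps) (simp add: power2_eq_square eval_nat_numeral algebra_simps)
  qed
  finally show ?thesis
    by (intro sums_nonneg_imp_has_sum) (simp_all add: P_def rho_coeff_nonneg)
qed

text \<open>The finite Euler products tend to the sum of the series and also, by splitting each
  factor, to the product defining \<open>D_const\<close>; limits are unique.\<close>

lemma D_const_has_sum: "((\<lambda>d. rho_coeff d / real d) has_sum D_const) {0<..}"
proof -
  define Z where "Z = (\<lambda>s N. \<Prod>p | prime p \<and> p \<le> N. 1 / (1 - real p powr -s))"
  define F where "F = (\<lambda>d. rho_coeff d * real d powr -1)"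
  have F: "F = (\<lambda>d. rho_coeff d / real d)" by (simp add: F_def powr_minus_divide)
  have "F summable_on {0<..}"
    unfolding F_def using rho_coeff_powr_summable(1)[of 1] by simp
  then have S: "(F has_sum infsum F {0<..}) {0<..}" by simp
  have "multiplicative F"
    unfolding F_def by (intro multiplicative_times multiplicative_rho_coeff multiplicative_powr)
  then have "(\<lambda>N. \<Prod>p | prime p \<and> p \<le> N. 1 / (1 - real p powr -2) * (1 / (1 - real p powr -3)) /
      (1 / (1 - real p powr -6)) * local_factor p) \<longlonglongrightarrow> infsum F {0<..}"
    using S rho_coeff_local_factor by (intro euler_product_tendsto) (auto simp: F rho_coeff_nonneg)
  then have lim: "(\<lambda>N. Z 2 N * Z 3 N / Z 6 N * (\<Prod>p | prime p \<and> p \<le> N. local_factor p))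
      \<longlonglongrightarrow> infsum F {0<..}"
    unfolding Z_def prod.distrib prod_dividef .
  have "(\<lambda>N. \<Prod>p\<le>N. if prime p then local_factor p else 1) \<longlonglongrightarrow>
      (\<Prod>p. if prime p then local_factor p else 1)"
    by (intro convergent_prod_LIMSEQ abs_convergent_prod_imp_convergent_prod abs_convergent_local_factor)
  also have "(\<lambda>N. \<Prod>p\<le>N. if prime p then local_factor p else 1) =
      (\<lambda>N. \<Prod>p | prime p \<and> p \<le> N. local_factor p)"
    by (intro ext prod.mono_neutral_cong_right) auto
  finally have "(\<lambda>N. Z 2 N * Z 3 N / Z 6 N * (\<Prod>p | prime p \<and> p \<le> N. local_factor p)) \<longlonglongrightarrow> D_const"
    unfolding D_const_def Z_def using zeta_pos[of 6]
    by (intro tendsto_mult tendsto_divide zeta_euler_product) auto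
  with lim have "infsum F {0<..} = D_const" by (rule LIMSEQ_unique)
  with S show ?thesis by (simp add: F)
qed

section \<open>The asymptotic formula\<close>

text \<open>For \<open>t >= 1\<close> the standard bounds for Euler's constant give an error of at
  most 1/t. For \<open>t < 1\<close> the harmonic number is 0 and the logarithm has to be dominated
  by a negative power of \<open>t\<close>.\<close>

lemma harm_floor_approx:
  fixes t e :: real
  assumes t: "t > 0" and e: "0 < e" "e \<le> 3 / 4"
  shows "\<bar>harm (nat \<lfloor>t\<rfloor>) - (ln t + euler_mascheroni)\<bar> \<le> 4 * t powr -(1 - e)"
proof (cases "t \<ge> 1")
  case True
  define n where "n = nat \<lfloor>t\<rfloor>"
  have n: "n \<ge> 1" "real n \<le> t" "t < real n + 1" using True by (auto simp: n_def le_nat_iff)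
  have "ln (real n + 1) - ln t = ln ((real n + 1) / t)" using t by (simp add: ln_div)
  also have "\<dots> \<le> (real n + 1) / t - 1" using t by (intro ln_le_minus_one) auto
  also have "\<dots> \<le> 1 / t" using t n by (simp add: field_simps)
  finally have "ln (real n + 1) - ln t \<le> 1 / t" .
  moreover have "ln t \<le> ln (real n + 1)" using t n by simp
  moreover have "harm n - ln (real n + 1) \<le> euler_mascheroni"
    and "euler_mascheroni \<le> harm n - ln (real n + 1) + 1 / t"
  proof -
    have *: "harm n - ln (real n + 1) + inverse (real (2 * (n + 1))) \<le> euler_mascheroni"
      "euler_mascheroni \<le> harm n - ln (real n + 1) + inverse (real (2 * n))"
      using euler_mascheroni_bounds[OF n(1)] by (simp_all add: add.commute)
    have "inverse (real (2 * n)) \<le> 1 / t" using n t by (simp add: field_simps)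
    then show "euler_mascheroni \<le> harm n - ln (real n + 1) + 1 / t" using *(2) by linarith
    have "inverse (real (2 * (n + 1))) \<ge> 0" by simp
    then show "harm n - ln (real n + 1) \<le> euler_mascheroni" using *(1) by linarith
  qed
  ultimately have "\<bar>harm n - (ln t + euler_mascheroni)\<bar> \<le> 1 / t" by (intro abs_leI) linarith+
  also have "\<dots> \<le> 4 * (1 / t)" using t by (simp add: divide_right_mono)
  also have "1 / t = t powr -1" using t by (simp add: powr_minus_divide)
  also have "\<dots> \<le> t powr -(1 - e)" using True e by (intro powr_mono) auto
  finally show ?thesis by (simp add: n_def)
next
  case False
  then have "nat \<lfloor>t\<rfloor> = 0" by (simp add: floor_le_iff)
  have "(1::real) \<le> harm 1" by (simp add: harm_def)
  have "euler_mascheroni \<le> harm 1 - ln (real (Suc 1)) + inverse (real (2 * 1))"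
    using euler_mascheroni_bounds[of 1] by simp
  then have gamma: "euler_mascheroni \<le> (1::real)" "euler_mascheroni > (0::real)"
    using ln2_ge_two_thirds euler_mascheroni_pos by (simp_all add: harm_def)
  \<comment> \<open>Here -ln t = 4 ln u <= 4 (u - 1), the source of the constant 4;
    \<open>e <= 3 / 4\<close> makes the exponent 1 - e at least 1/4.\<close>
  define u where "u = t powr -(1 / 4)"
  have "ln u \<le> u - 1" using t by (intro ln_le_minus_one) (simp add: u_def)
  moreover have "ln u = - ln t / 4" using t by (simp add: u_def ln_powr)
  moreover have "ln t < 0" using t False by simp
  ultimately have "\<bar>ln t + euler_mascheroni\<bar> \<le> 4 * u" using gamma by linarith
  also have "u \<le> t powr -(1 - e)" unfolding u_def using t False e by (intro powr_mono') auto
  finally show ?thesis using \<open>nat \<lfloor>t\<rfloor> = 0\<close> by (simp add: harm_def)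
qed

text \<open>Expand 1/rho(n) as the divisor sum of g(d)/n, write n = d m, and sum over m for fixed
  d.\<close>

lemma sum_inverse_rho:
  "(\<Sum>n\<in>{1..N}. 1 / real (rho n)) = (\<Sum>d\<in>{1..N}. rho_coeff d / real d * harm (N div d))"
proof -
  have "(\<Sum>n\<in>{1..N}. 1 / real (rho n)) = (\<Sum>n\<in>{1..N}. \<Sum>d | d dvd n. rho_coeff d / real n)"
    by (intro sum.cong refl) (simp add: sum_divide_distrib[symmetric] sum_divisors_rho_coeff)
  also have "\<dots> = (\<Sum>(n, d)\<in>(SIGMA n:{1..N}. {d. d dvd n}). rho_coeff d / real n)"
    by (subst sum.Sigma) auto
  also have "\<dots> = (\<Sum>(d, m)\<in>(SIGMA d:{1..N}. {1..N div d}). rho_coeff d / (real d * real m))"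
  proof (rule sum.reindex_bij_witness[where i = "\<lambda>(d, m). (d * m, d)" and j = "\<lambda>(n, d). (d, n div d)"])
    fix a assume "a \<in> (SIGMA n:{1..N}. {d. d dvd n})"
    then obtain n d where a: "a = (n, d)" "1 \<le> n" "n \<le> N" "d dvd n" by auto
    then obtain m where m: "n = d * m" "d > 0" "m > 0" by (auto elim!: dvdE)
    moreover have "d \<le> N" using dvd_imp_le[OF a(4)] a(2,3) by linarith
    moreover have "m \<le> N div d" using a m by (simp add: less_eq_div_iff_mult_less_eq mult.commute)
    ultimately show "(case a of (n, d) \<Rightarrow> (d, n div d)) \<in> (SIGMA d:{1..N}. {1..N div d})"
      and "(case case a of (n, d) \<Rightarrow> (d, n div d) of (d, m) \<Rightarrow> (d * m, d)) = a"
      and "(case case a of (n, d) \<Rightarrow> (d, n div d) of (d, m) \<Rightarrow> rho_coeff d / (real d * real m)) =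
        (case a of (n, d) \<Rightarrow> rho_coeff d / real n)"
      by (simp_all add: a(1))
  next
    fix b assume "b \<in> (SIGMA d:{1..N}. {1..N div d})"
    then obtain d m where b: "b = (d, m)" "1 \<le> d" "1 \<le> m" "m \<le> N div d" by auto
    then have "d * m \<le> N" by (simp add: less_eq_div_iff_mult_less_eq mult.commute)
    then show "(case b of (d, m) \<Rightarrow> (d * m, d)) \<in> (SIGMA n:{1..N}. {d. d dvd n})"
      and "(case case b of (d, m) \<Rightarrow> (d * m, d) of (n, d) \<Rightarrow> (d, n div d)) = b"
      using b by simp_all
  qed
  also have "\<dots> = (\<Sum>d\<in>{1..N}. \<Sum>m\<in>{1..N div d}. rho_coeff d / (real d * real m))"
    by (subst sum.Sigma) auto
  also have "\<dots> = (\<Sum>d\<in>{1..N}. rho_coeff d / real d * harm (N div d))"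
    by (intro sum.cong refl) (simp add: harm_def sum_distrib_left divide_inverse mult.assoc)
  finally show ?thesis .
qed

text \<open>This series enters the constant \<open>E\<close>. Since ln d <= 2 d^(1/2), it is
  dominated by the Dirichlet series at e = 1/2.\<close>

lemma rho_coeff_ln_summable: "(\<lambda>d. rho_coeff d / real d * ln (real d)) summable_on {0<..}"
proof (rule summable_on_comparison_test)
  show "(\<lambda>d. 2 * (rho_coeff d * real d powr -(1 / 2))) summable_on {0<..}"
    by (intro summable_on_cmult_right rho_coeff_powr_summable) auto
  fix d :: nat assume d: "d \<in> {0<..}"
  have "ln (real d powr (1 / 2)) \<le> real d powr (1 / 2) - 1"
    using d by (intro ln_le_minus_one) auto
  then have "ln (real d) \<le> 2 * real d powr (1 / 2)" using d by (simp add: ln_powr)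
  then have "rho_coeff d / real d * ln (real d) \<le> rho_coeff d / real d * (2 * real d powr (1 / 2))"
    by (intro mult_left_mono) (simp_all add: rho_coeff_nonneg)
  also have "\<dots> = 2 * (rho_coeff d * (real d powr (1 / 2) / real d powr 1))" using d by simp
  also have "real d powr (1 / 2) / real d powr 1 = real d powr -(1 / 2)"
    by (subst powr_diff[symmetric]) simp
  finally show "rho_coeff d / real d * ln (real d) \<le> 2 * (rho_coeff d * real d powr -(1 / 2))" .
qed (auto simp: rho_coeff_nonneg)

theorem theorem6:
  shows "\<exists>E C :: real. \<forall>x::real. x \<ge> 2 \<longrightarrow>
    \<bar>(\<Sum>n\<in>{1..nat \<lfloor>x\<rfloor>}. 1 / real (rho n)) - (D_const * ln x + E)\<bar> \<le> C * (ln x ^ 9 / x)"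
proof -
  define c where "c = (\<lambda>d. rho_coeff d / real d)"
  \<comment> \<open>The part independent of \<open>x\<close> in the sum of c(d) (ln(x/d) +
    euler_mascheroni) over all d.\<close>
  define E where "E = euler_mascheroni * D_const - infsum (\<lambda>d. c d * ln (real d)) {0<..}"
  \<comment> \<open>Collects 4 from \<open>harm_floor_approx\<close>, exp(1/2) = x^e, exp 8 from the
    Dirichlet series, and 4 from 1 + 1/e <= 4 ln x.\<close>
  define K where "K = 4 * exp (1 / 2) * (exp 8 * (4::real))"
  have main: "\<bar>(\<Sum>n\<in>{1..nat \<lfloor>x\<rfloor>}. 1 / real (rho n)) - (D_const * ln x + E)\<bar>
      \<le> K * (3 / 2) ^ 8 * (ln x ^ 9 / x)" if x: "x \<ge> 2" for x :: real
  proof -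
    have "ln 2 \<le> ln x" using x by simp
    then have lnx: "ln x \<ge> 2 / 3" using ln2_ge_two_thirds by linarith
    \<comment> \<open>This choice makes x^e constant and 1/e = 2 ln x; the bound ln x >= 2/3 ensures
      \<open>e <= 3 / 4\<close>.\<close>
    define e where "e = 1 / (2 * ln x)"
    have e: "0 < e" "e \<le> 3 / 4" using lnx by (auto simp: e_def field_simps)
    define S where "S = (\<Sum>n\<in>{1..nat \<lfloor>x\<rfloor>}. 1 / real (rho n))"
    define r where "r = (\<lambda>d. c d * harm (nat \<lfloor>x / real d\<rfloor>) - c d * (ln (x / real d) + euler_mascheroni))"
    have floor: "nat \<lfloor>x / real d\<rfloor> = nat \<lfloor>x\<rfloor> div d" for d
      using floor_divide_real_eq_div[of "int d" x] x by (simp add: nat_div_distrib)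
    have "S = (\<Sum>d\<in>{1..nat \<lfloor>x\<rfloor>}. c d * harm (nat \<lfloor>x / real d\<rfloor>))"
      unfolding S_def sum_inverse_rho by (simp add: c_def floor)
    then have "((\<lambda>d. c d * harm (nat \<lfloor>x / real d\<rfloor>)) has_sum S) {1..nat \<lfloor>x\<rfloor>}"
      by (intro has_sum_finiteI) auto
    \<comment> \<open>For d > x the argument of \<open>harm\<close> is 0, so the finite sum extends
      to all positive d.\<close>
    also have "?this \<longleftrightarrow> ((\<lambda>d. c d * harm (nat \<lfloor>x / real d\<rfloor>)) has_sum S) {0<..}"
      by (intro has_sum_cong_neutral) (auto simp: floor harm_def)
    finally have sum1: "((\<lambda>d. c d * harm (nat \<lfloor>x / real d\<rfloor>)) has_sum S) {0<..}" .
    have "((\<lambda>d. (ln x + euler_mascheroni) * c d - c d * ln (real d)) has_sum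
        ((ln x + euler_mascheroni) * D_const - infsum (\<lambda>d. c d * ln (real d)) {0<..})) {0<..}"
      using D_const_has_sum rho_coeff_ln_summable unfolding c_def
      by (intro has_sum_diff has_sum_cmult_right has_sum_infsum)
    also have "(ln x + euler_mascheroni) * D_const - infsum (\<lambda>d. c d * ln (real d)) {0<..} =
        D_const * ln x + E"
      by (simp add: E_def algebra_simps)
    also have "((\<lambda>d. (ln x + euler_mascheroni) * c d - c d * ln (real d)) has_sum (D_const * ln x + E)) {0<..}
      \<longleftrightarrow> ((\<lambda>d. c d * (ln (x / real d) + euler_mascheroni)) has_sum (D_const * ln x + E)) {0<..}"
      using x by (intro has_sum_cong) (auto simp: ln_div algebra_simps)
    finally have rsum: "(r has_sum (S - (D_const * ln x + E))) {0<..}"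
      unfolding r_def using sum1 by (intro has_sum_diff)
    have bound: "\<bar>r d\<bar> \<le> 4 * x powr -(1 - e) * (rho_coeff d * real d powr -e)" if "d \<in> {0<..}" for d
    proof -
      have d: "real d > 0" using that by simp
      have "r d = c d * (harm (nat \<lfloor>x / real d\<rfloor>) - (ln (x / real d) + euler_mascheroni))"
        by (simp only: r_def right_diff_distrib)
      moreover have "c d \<ge> 0" by (simp add: c_def rho_coeff_nonneg)
      ultimately have "\<bar>r d\<bar> =
          c d * \<bar>harm (nat \<lfloor>x / real d\<rfloor>) - (ln (x / real d) + euler_mascheroni)\<bar>"
        by (simp add: abs_mult)
      also have "\<dots> \<le> c d * (4 * (x / real d) powr -(1 - e))"
        using d x e by (intro mult_left_mono harm_floor_approx) (auto simp: c_def rho_coeff_nonneg)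
      \<comment> \<open>The factor d cancels the denominator of \<open>c d\<close> and leaves a term
        of the Dirichlet series at \<open>e\<close>.\<close>
      also have "(x / real d) powr -(1 - e) = x powr -(1 - e) * (real d * real d powr -e)"
        using d x by (simp add: powr_divide powr_diff powr_minus field_simps)
      finally show ?thesis using d by (simp add: c_def mult_ac)
    qed
    define Z where "Z = infsum (\<lambda>d. rho_coeff d * real d powr -e) {0<..}"
    have Zsum: "((\<lambda>d. 4 * x powr -(1 - e) * (rho_coeff d * real d powr -e)) has_sum
        (4 * x powr -(1 - e) * Z)) {0<..}"
      unfolding Z_def using rho_coeff_powr_summable(1)[OF e(1)]
      by (intro has_sum_cmult_right has_sum_infsum)
    have "\<bar>S - (D_const * ln x + E)\<bar> \<le> 4 * x powr -(1 - e) * Z"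
    proof (rule abs_leI)
      show "S - (D_const * ln x + E) \<le> 4 * x powr -(1 - e) * Z"
        by (rule has_sum_mono[OF rsum Zsum]) (use bound abs_le_D1 in blast)
      show "- (S - (D_const * ln x + E)) \<le> 4 * x powr -(1 - e) * Z"
        by (rule has_sum_mono[OF has_sum_uminusI[OF rsum] Zsum]) (use bound abs_le_D2 in blast)
    qed
    also have "\<dots> \<le> 4 * x powr -(1 - e) * (exp 8 * (1 + 1 / e))"
      unfolding Z_def using rho_coeff_powr_summable(2)[OF e(1)] by (intro mult_left_mono) auto
    also have "x powr -(1 - e) = exp (1 / 2) / x"
    proof -
      have "x powr -(1 - e) = x powr e / x" using x by (simp add: powr_diff)
      also have "x powr e = exp (1 / 2)" using x lnx by (simp add: powr_def e_def)
      finally show ?thesis .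
    qed
    also have "4 * (exp (1 / 2) / x) * (exp 8 * (1 + 1 / e)) \<le> 4 * (exp (1 / 2) / x) * (exp 8 * (4 * ln x))"
      using x lnx by (intro mult_left_mono) (auto simp: e_def)
    also have "\<dots> = K * (ln x / x)" by (simp add: K_def)
    \<comment> \<open>Weakening to the ninth power: ln x >= 2/3 gives (3/2 ln x)^8 >= 1.\<close>
    also have "ln x / x \<le> (3 / 2) ^ 8 * (ln x ^ 9 / x)"
    proof -
      have "(1::real) = (3 / 2 * (2 / 3)) ^ 8" by simp
      also have "\<dots> \<le> (3 / 2 * ln x) ^ 8" using lnx by (intro power_mono mult_left_mono) auto
      finally have "ln x * 1 \<le> ln x * (3 / 2 * ln x) ^ 8" using lnx by (intro mult_left_mono) auto
      also have "\<dots> = (3 / 2) ^ 8 * (ln x * ln x ^ 8)"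
        by (subst power_mult_distrib) (rule mult.left_commute)
      also have "ln x * ln x ^ 8 = ln x ^ 9" by (simp flip: power_Suc)
      finally show ?thesis using x by (simp add: divide_right_mono)
    qed
    finally show ?thesis by (simp add: S_def K_def mult.assoc)
  qed
  then show ?thesis by blast
qed

end
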